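(* Suppose that either $\mathbb{X}$ is a discrete space, or that $\mathbb{U}$ is equipped with a topology, its $\sigma$-algebra contains all the open sets, and each set $\mathbb{U}_x(A)$ is replaced by its closure. Fix $A \subseteq \Theta$ and assume that $\Theta_x(u) \neq \varnothing$ for all $x \in \mathbb{X}$ and all $u \in \mathbb{U}$. Given any valid predictive random set $\mathcal{S}$, there exists a nested and valid predictive random set $\mathcal{S}'$ such that $$\mathsf{bel}_x(A;\mathcal{S}') \geq \mathsf{bel}_x(A;\mathcal{S}) \quad \text{for each } x \in \mathbb{X}.$$
   Context: Setting. $\mathbb{X}$ is the sample space, $\Theta$ the parameter space, and $(\mathbb{U}, \mathsf{P}_U)$ a probability space (the auxiliary variable space). An association is a map $a$ taking $(u,\theta)\in\mathbb{U}\times\Theta$ to $a(u,\theta) \in \mathbb{X}$ such that, for each $\theta\in\Theta$, the sampling distribution $\mathsf{P}_{X|\theta}$ of the observable $X$ is the distribution of $a(U,\theta)$ when $U \sim \mathsf{P}_U$. For $x \in \mathbb{X}$, $u \in \mathbb{U}$, put $\Theta_x(u) = \{\theta \in \Theta : x = a(u,\theta)\}$. A predictive random set $\mathcal{S}$ is a random subset of $\mathbb{U}$ with distribution $\mathsf{P}_{\mathcal{S}}$. Put $Q_{\mathcal{S}}(u) = \mathsf{P}_{\mathcal{S}}\{\mathcal{S} \not\ni u\}$ (assumed measurable in $u$). $\mathcal{S}$ is valid if $\mathsf{P}_U\{Q_{\mathcal{S}}(U) \geq 1-\alpha\} \leq \alpha$ for each $\alpha \in (0,1)$, where $U\sim\mathsf{P}_U$.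 A collection of subsets of $\mathbb{U}$ is nested if for any two members $S, S'$ either $S \subseteq S'$ or $S' \subseteq S$; a predictive random set is nested if it is supported on (takes values in) a nested collection of $\mathsf{P}_U$-measurable sets, at least one of which has positive $\mathsf{P}_U$-probability. For $A\subseteq\Theta$, put $\mathbb{U}_x(A) = \{u \in \mathbb{U} : \Theta_x(u) \subseteq A\}$ (assumed $\mathsf{P}_U$-measurable). With $\Theta_x(\mathcal{S}) = \bigcup_{u\in\mathcal{S}} \Theta_x(u)$, the belief function is $\mathsf{bel}_x(A;\mathcal{S}) = \mathsf{P}_{\mathcal{S}}\{\Theta_x(\mathcal{S}) \subseteq A\} = \mathsf{P}_{\mathcal{S}}\{\mathcal{S} \subseteq \mathbb{U}_x(A)\}$ (no conditioning is needed because all $\Theta_x(u)$ are non-empty). In the second alternative of the hypothesis, where $\mathbb{U}_x(A)$ is replaced by its closure $\overline{\mathbb{U}_x(A)}$, the belief functions of both $\mathcal{S}$ and $\mathcal{S}'$ are computed with the closed sets, i.e. $\mathsf{bel}_x(A;\cdot) = \mathsf{P}\{\,\cdot \subseteq \overline{\mathbb{U}_x(A)}\}$. *)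

theory Defs
  imports "HOL-Probability.Probability"
begin

definition association ::
  "'x measure \<Rightarrow> ('p \<Rightarrow> 'x measure) \<Rightarrow> 'p set \<Rightarrow> 'u measure \<Rightarrow> ('u \<Rightarrow> 'p \<Rightarrow> 'x) \<Rightarrow> bool" where
  "association MX PX \<Theta> PU a \<longleftrightarrow>
     prob_space PU \<and>
     (\<forall>\<theta>\<in>\<Theta>. (\<lambda>u. a u \<theta>) \<in> measurable PU MX \<and> PX \<theta> = distr PU MX (\<lambda>u. a u \<theta>))"

text \<open>Discreteness of a sample space is meant in the statistical sense, which includes countability.\<close>

definition discrete_space :: "'x measure \<Rightarrow> bool" where
  "discrete_space MX \<longleftrightarrow> countable (space MX) \<and> sets MX = Pow (space MX)"

definition Theta_pt :: "'p set \<Rightarrow> ('u \<Rightarrow> 'p \<Rightarrow> 'x) \<Rightarrow> 'x \<Rightarrow> 'u \<Rightarrow> 'p set" where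
  "Theta_pt \<Theta> a x u = {\<theta> \<in> \<Theta>. x = a u \<theta>}"

definition Theta_set :: "'p set \<Rightarrow> ('u \<Rightarrow> 'p \<Rightarrow> 'x) \<Rightarrow> 'x \<Rightarrow> 'u set \<Rightarrow> 'p set" where
  "Theta_set \<Theta> a x S = (\<Union>u\<in>S. Theta_pt \<Theta> a x u)"

definition U_set :: "'u measure \<Rightarrow> 'p set \<Rightarrow> ('u \<Rightarrow> 'p \<Rightarrow> 'x) \<Rightarrow> 'p set \<Rightarrow> 'x \<Rightarrow> 'u set" where
  "U_set PU \<Theta> a A x = {u \<in> space PU. Theta_pt \<Theta> a x u \<subseteq> A}"

text \<open>A random subset of the auxiliary space is represented by its distribution, a probability
  measure \<open>PS\<close> whose points are subsets of \<open>space PU\<close>.\<close>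

definition Q_fun :: "'u set measure \<Rightarrow> 'u \<Rightarrow> real" where
  "Q_fun PS u = measure PS {S \<in> space PS. u \<notin> S}"

definition predictive_random_set :: "'u measure \<Rightarrow> 'u set measure \<Rightarrow> bool" where
  "predictive_random_set PU PS \<longleftrightarrow>
     prob_space PS \<and> space PS \<subseteq> Pow (space PU) \<and>
     (\<forall>u\<in>space PU. {S \<in> space PS. u \<notin> S} \<in> sets PS) \<and>
     Q_fun PS \<in> borel_measurable PU"

definition valid_prs :: "'u measure \<Rightarrow> 'u set measure \<Rightarrow> bool" where
  "valid_prs PU PS \<longleftrightarrow>
     (\<forall>\<alpha>\<in>{0<..<1::real}. measure PU {u \<in> space PU. Q_fun PS u \<ge> 1 - \<alpha>} \<le> \<alpha>)"

definition nested :: "'u set set \<Rightarrow> bool" where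
  "nested \<C> \<longleftrightarrow> (\<forall>S\<in>\<C>. \<forall>S'\<in>\<C>. S \<subseteq> S' \<or> S' \<subseteq> S)"

definition nested_prs :: "'u measure \<Rightarrow> 'u set measure \<Rightarrow> bool" where
  "nested_prs PU PS \<longleftrightarrow>
     (\<exists>\<C>. nested \<C> \<and> \<C> \<subseteq> sets PU \<and> (\<exists>S\<in>\<C>. measure PU S > 0) \<and> space PS \<subseteq> \<C>)"

definition bel_event ::
  "'p set \<Rightarrow> ('u \<Rightarrow> 'p \<Rightarrow> 'x) \<Rightarrow> 'p set \<Rightarrow> 'u set measure \<Rightarrow> 'x \<Rightarrow> 'u set set" where
  "bel_event \<Theta> a A PS x = {S \<in> space PS. Theta_set \<Theta> a x S \<subseteq> A}"

definition bel ::
  "'p set \<Rightarrow> ('u \<Rightarrow> 'p \<Rightarrow> 'x) \<Rightarrow> 'p set \<Rightarrow> 'u set measure \<Rightarrow> 'x \<Rightarrow> real" where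
  "bel \<Theta> a A PS x = measure PS (bel_event \<Theta> a A PS x)"

lemma bel_event_eq:
  assumes "space PS \<subseteq> Pow (space PU)"
  shows "bel_event \<Theta> a A PS x = {S \<in> space PS. S \<subseteq> U_set PU \<Theta> a A x}"
  using assms unfolding bel_event_def Theta_set_def U_set_def by blast

definition bel_event_closed ::
  "'u topology \<Rightarrow> 'u measure \<Rightarrow> 'p set \<Rightarrow> ('u \<Rightarrow> 'p \<Rightarrow> 'x) \<Rightarrow> 'p set \<Rightarrow> 'u set measure \<Rightarrow> 'x
    \<Rightarrow> 'u set set" where
  "bel_event_closed T PU \<Theta> a A PS x = {S \<in> space PS. S \<subseteq> T closure_of (U_set PU \<Theta> a A x)}"

definition bel_closed ::
  "'u topology \<Rightarrow> 'u measure \<Rightarrow> 'p set \<Rightarrow> ('u \<Rightarrow> 'p \<Rightarrow> 'x) \<Rightarrow> 'p set \<Rightarrow> 'u set measure \<Rightarrow> 'x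
    \<Rightarrow> real" where
  "bel_closed T PU \<Theta> a A PS x = measure PS (bel_event_closed T PU \<Theta> a A PS x)"

end

(* Put b(x) = P(S \<subseteq> V_x), with V_x either U_x(A) or its closure, and let T be uniform on [0,1].
   The sets C_t = {u. u \<in> V_y whenever b(y) \<ge> t} increase with t, and S' = C_T works:
   T \<le> b(x) forces C_T \<subseteq> V_x, so P(S' \<subseteq> V_x) \<ge> b(x), while u \<notin> C_T forces T \<le> b(y) for
   some y with u \<notin> V_y, and b(y) = P(S \<subseteq> V_y) \<le> P(u \<notin> S); hence the new Q-function is
   dominated by the old one and validity is inherited. *)

theory Submission
  imports Defs
begin

text \<open>A down-set of reals is an interval, namely empty, a ray or the whole line. This settles
  measurability of all events about the random threshold, however large the index set is.\<close>

lemma down_closed_borel: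
  fixes D :: "real set"
  assumes "\<And>s t. t \<in> D \<Longrightarrow> s \<le> t \<Longrightarrow> s \<in> D"
  shows "D \<in> sets borel"
proof -
  have "is_interval D"
    unfolding is_interval_1 using assms by blast
  then show ?thesis
    by (rule real_interval_borel_measurable)
qed

text \<open>The law of the threshold lives on the whole real line with its mass on [0,1], so events
  can be compared directly with rays \<open>{..c}\<close>.\<close>

abbreviation unif01 :: "real measure" where
  "unif01 \<equiv> uniform_measure lborel {0..1}"

lemma prob_space_unif01: "prob_space unif01"
  by (rule prob_space_uniform_measure) auto

lemma measure_unif01_atMost:
  assumes "0 \<le> c" "c \<le> 1"
  shows "measure unif01 {..c} = c"
proof -
  have "{0..1} \<inter> {..c} = {0..c}" using assms(2) by auto
  then have "measure unif01 {..c} = measure lborel {0..c} / measure lborel {0..1::real}"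
    by (subst measure_uniform_measure) auto
  then show ?thesis using assms(1) by simp
qed

text \<open>Monotonicity against the ray \<open>{..c}\<close>, or the trivial bound 1 once
  \<open>c\<close> exceeds 1.\<close>

lemma measure_unif01_le:
  assumes "D \<subseteq> {..c}" "0 \<le> c"
  shows "measure unif01 D \<le> c"
proof -
  interpret prob_space unif01 by (rule prob_space_unif01)
  show ?thesis
  proof (cases "c \<le> 1")
    case True
    have "measure unif01 D \<le> measure unif01 {..c}"
      using assms(1) by (intro finite_measure_mono) auto
    with True show ?thesis
      using assms(2) by (simp only: measure_unif01_atMost)
  next
    case False
    then show ?thesis using prob_le_1[of D] by linarith
  qed
qed

lemma measure_unif01_ge:
  assumes "{..c} \<subseteq> D" "D \<in> sets borel" "0 \<le> c" "c \<le> 1"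
  shows "c \<le> measure unif01 D"
proof -
  interpret prob_space unif01 by (rule prob_space_unif01)
  have "measure unif01 {..c} \<le> measure unif01 D"
    using assms by (intro finite_measure_mono) auto
  then show ?thesis
    using assms(3,4) by (simp only: measure_unif01_atMost)
qed

text \<open>Common core of both alternatives, with \<open>V\<close> standing for the sets U_x(A) or
  their closures. The index sets J that occur are cut out by thresholds on \<open>b\<close> and may
  be uncountable, so measurability of these unions is what discreteness or the topology has to
  supply.\<close>

lemma nested_prs_dominating:
  fixes V :: "'i \<Rightarrow> 'u set" and PU :: "'u measure" and PS :: "'u set measure"
  assumes PU: "prob_space PU"
    and prs: "predictive_random_set PU PS"
    and valid: "valid_prs PU PS"
    and V: "\<And>J. J \<subseteq> I \<Longrightarrow> (\<Union>y\<in>J. space PU - V y) \<in> sets PU"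
  shows "\<exists>PS'. predictive_random_set PU PS' \<and> nested_prs PU PS' \<and> valid_prs PU PS' \<and>
           (\<forall>x\<in>I. {S \<in> space PS'. S \<subseteq> V x} \<in> sets PS' \<and>
              measure PS {S \<in> space PS. S \<subseteq> V x} \<le> measure PS' {S \<in> space PS'. S \<subseteq> V x})"
proof -
  interpret PU: prob_space PU by (rule PU)
  interpret PS: prob_space PS using prs by (simp add: predictive_random_set_def)
  interpret unif: prob_space unif01 by (rule prob_space_unif01)
  define b where "b y = measure PS {S \<in> space PS. S \<subseteq> V y}" for y
  have b01: "0 \<le> b y" "b y \<le> 1" for y
    by (auto simp: b_def)
  define C where "C t = {u \<in> space PU. \<forall>y\<in>I. t \<le> b y \<longrightarrow> u \<in> V y}" for t
  have C_mono: "C s \<subseteq> C t" if "s \<le> t" for s t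
    using that unfolding C_def by fastforce
  \<comment> \<open>This form brings \<open>C t\<close> under the hypothesis on unions of
    complements.\<close>
  have C_compl: "C t = space PU - (\<Union>y\<in>{y \<in> I. t \<le> b y}. space PU - V y)" for t
    unfolding C_def by blast
  have C_sets: "C t \<in> sets PU" for t
    unfolding C_compl by (intro sets.Diff sets.top V) auto
  (* Every event needed about C_T is a down-set of the chain (C_t), so its preimage under the
     monotone map C is a ray, hence Borel. *)
  define \<D> where "\<D> = {D. D \<subseteq> range C \<and> (\<forall>S\<in>D. \<forall>S'\<in>range C. S' \<subseteq> S \<longrightarrow> S' \<in> D)}"
  \<comment> \<open>The space of \<open>N\<close> is exactly the chain, so the support of
    \<open>PS'\<close> can be read off its space.\<close>
  define N where "N = sigma (range C) \<D>"
  define PS' where "PS' = distr unif01 N C"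
  have D_Pow: "\<D> \<subseteq> Pow (range C)"
    unfolding \<D>_def by blast
  have space_N: "space N = range C" and D_sets: "\<D> \<subseteq> sets N"
    using D_Pow by (auto simp: N_def space_measure_of_conv)
  have pre_borel: "C -` D \<in> sets borel" if "D \<in> \<D>" for D
  proof (rule down_closed_borel)
    show "s \<in> C -` D" if "t \<in> C -` D" "s \<le> t" for s t
    proof -
      have "C t \<in> D" "C s \<subseteq> C t"
        using that C_mono by auto
      then show ?thesis
        using \<open>D \<in> \<D>\<close> unfolding \<D>_def by blast
    qed
  qed
  have C_meas: "C \<in> measurable unif01 N"
    unfolding N_def using D_Pow pre_borel by (intro measurable_measure_of) auto
  have space': "space PS' = range C" and sets': "sets PS' = sets N"
    by (auto simp: PS'_def space_N)
  have measure': "measure PS' D = measure unif01 (C -` D)" if "D \<in> \<D>" for D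
    using that D_sets by (auto simp: PS'_def measure_distr[OF C_meas])
  have subset_D: "{S \<in> space PS'. S \<subseteq> W} \<in> \<D>" for W
    unfolding space' \<D>_def by blast
  have notin_D: "{S \<in> space PS'. u \<notin> S} \<in> \<D>" for u
    unfolding space' \<D>_def by blast
  define G where "G u = C -` {S \<in> space PS'. u \<notin> S}" for u
  have G_eq: "G u = {t. \<exists>y\<in>I. t \<le> b y \<and> u \<notin> V y}" if "u \<in> space PU" for u
    using that unfolding G_def space' C_def by auto
  have Q': "Q_fun PS' u = measure unif01 (G u)" for u
    unfolding Q_fun_def G_def by (rule measure'[OF notin_D])
  \<comment> \<open>\<open>G u\<close> is a union of rays \<open>{..b y}\<close>, so Q'(u) is the
    supremum of \<open>b y\<close> over the y in \<open>I\<close> with u outside \<open>V y\<close>,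
    or 0 if there are none. The supremum need not be attained, which is why strict superlevel sets
    are used: they are unions of complements. The condition on \<open>c\<close> takes care of the
    value 0.\<close>
  have Q'_gt: "{u \<in> space PU. c < Q_fun PS' u} = (\<Union>y\<in>{y \<in> I. c < b y}. space PU - V y)"
    if "0 \<le> c" for c
  proof -
    have "c < Q_fun PS' u \<longleftrightarrow> (\<exists>y\<in>I. c < b y \<and> u \<notin> V y)" if u: "u \<in> space PU" for u
    proof
      assume "c < Q_fun PS' u"
      then show "\<exists>y\<in>I. c < b y \<and> u \<notin> V y"
        using measure_unif01_le[of "G u" c] \<open>0 \<le> c\<close> unfolding Q' G_eq[OF u] by fastforce
    next
      assume "\<exists>y\<in>I. c < b y \<and> u \<notin> V y"
      then obtain y where y: "y \<in> I" "c < b y" "u \<notin> V y" by blast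
      have "b y \<le> measure unif01 (G u)"
      proof (rule measure_unif01_ge)
        show "{..b y} \<subseteq> G u" using y unfolding G_eq[OF u] by auto
        show "G u \<in> sets borel" unfolding G_def by (rule pre_borel[OF notin_D])
      qed (rule b01)+
      then show "c < Q_fun PS' u" using y unfolding Q' by simp
    qed
    then show ?thesis by blast
  qed
  have Q'_meas: "Q_fun PS' \<in> borel_measurable PU"
  proof (rule borel_measurableI_greater)
    fix c
    show "{u \<in> space PU. c < Q_fun PS' u} \<in> sets PU"
    proof (cases "0 \<le> c")
      case True
      show ?thesis unfolding Q'_gt[OF True] by (rule V) auto
    next
      case False
      then have "{u \<in> space PU. c < Q_fun PS' u} = space PU"
        by (auto simp: Q_fun_def intro: less_le_trans[OF _ measure_nonneg])
      then show ?thesis by simp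
    qed
  qed
  have Q'_le: "Q_fun PS' u \<le> Q_fun PS u" if u: "u \<in> space PU" for u
  proof -
    \<comment> \<open>A set inside \<open>V y\<close> misses every u outside \<open>V y\<close>.
      Monotonicity asks for measurability of the larger event, which is part of being a predictive
      random set.\<close>
    have "b y \<le> Q_fun PS u" if "u \<notin> V y" for y
      unfolding b_def Q_fun_def using prs u that
      by (intro PS.finite_measure_mono) (auto simp: predictive_random_set_def)
    then have "G u \<subseteq> {..Q_fun PS u}"
      unfolding G_eq[OF u] by force
    then show ?thesis
      unfolding Q' by (rule measure_unif01_le) (simp add: Q_fun_def)
  qed
  have prs': "predictive_random_set PU PS'"
    unfolding predictive_random_set_def
  proof (intro conjI ballI)
    show "prob_space PS'"
      unfolding PS'_def by (rule unif.prob_space_distr[OF C_meas])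
    show "space PS' \<subseteq> Pow (space PU)"
      unfolding space' C_def by blast
    show "{S \<in> space PS'. u \<notin> S} \<in> sets PS'" for u
      using notin_D D_sets unfolding sets' by blast
  qed (rule Q'_meas)
  have nested': "nested_prs PU PS'"
    unfolding nested_prs_def
  proof (intro exI conjI)
    have "C s \<subseteq> C t \<or> C t \<subseteq> C s" for s t
      using C_mono linear by metis
    moreover have "C t \<subseteq> space PU" for t
      unfolding C_def by blast
    \<comment> \<open>Adjoining the full space keeps the chain nested and exhibits a member of
      probability 1.\<close>
    ultimately show "nested (insert (space PU) (range C))"
      unfolding nested_def by blast
    show "insert (space PU) (range C) \<subseteq> sets PU"
      using C_sets by auto
    show "\<exists>S\<in>insert (space PU) (range C). 0 < measure PU S"
      by (simp add: PU.prob_space)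
    show "space PS' \<subseteq> insert (space PU) (range C)"
      unfolding space' by blast
  qed
  have valid': "valid_prs PU PS'"
    unfolding valid_prs_def
  proof
    fix \<alpha> :: real
    assume \<alpha>: "\<alpha> \<in> {0<..<1}"
    have [measurable]: "Q_fun PS \<in> borel_measurable PU"
      using prs by (simp add: predictive_random_set_def)
    have "measure PU {u \<in> space PU. 1 - \<alpha> \<le> Q_fun PS' u} \<le> measure PU {u \<in> space PU. 1 - \<alpha> \<le> Q_fun PS u}"
      using Q'_le by (intro PU.finite_measure_mono) (force, measurable)
    also have "\<dots> \<le> \<alpha>"
      using valid \<alpha> unfolding valid_prs_def by blast
    finally show "measure PU {u \<in> space PU. 1 - \<alpha> \<le> Q_fun PS' u} \<le> \<alpha>" .
  qed
  have "b x \<le> measure PS' {S \<in> space PS'. S \<subseteq> V x}" if "x \<in> I" for x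
    unfolding measure'[OF subset_D]
  proof (rule measure_unif01_ge)
    show "{..b x} \<subseteq> C -` {S \<in> space PS'. S \<subseteq> V x}"
      using that unfolding space' C_def by auto
  qed (rule pre_borel[OF subset_D] b01)+
  moreover have "{S \<in> space PS'. S \<subseteq> V x} \<in> sets PS'" for x
    using subset_D D_sets unfolding sets' by blast
  ultimately show ?thesis
    using prs' nested' valid' unfolding b_def by blast
qed

theorem mainTheorem2:
  fixes MX :: "'x measure" and PX :: "'p \<Rightarrow> 'x measure" and \<Theta> :: "'p set"
    and PU :: "'u measure" and a :: "'u \<Rightarrow> 'p \<Rightarrow> 'x" and A :: "'p set"
    and PS :: "'u set measure"
  assumes "association MX PX \<Theta> PU a"
    and "A \<subseteq> \<Theta>"
    and "\<forall>x\<in>space MX. \<forall>u\<in>space PU. Theta_pt \<Theta> a x u \<noteq> {}"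
    and "\<forall>x\<in>space MX. U_set PU \<Theta> a A x \<in> sets PU"
    and "predictive_random_set PU PS"
    and "valid_prs PU PS"
  shows "(discrete_space MX \<and>
          (\<forall>x\<in>space MX. bel_event \<Theta> a A PS x \<in> sets PS) \<longrightarrow>
            (\<exists>PS'. predictive_random_set PU PS' \<and> nested_prs PU PS' \<and> valid_prs PU PS' \<and>
              (\<forall>x\<in>space MX. bel_event \<Theta> a A PS' x \<in> sets PS' \<and>
                 bel \<Theta> a A PS' x \<ge> bel \<Theta> a A PS x)))
       \<and> (\<forall>T. topspace T = space PU \<and> (\<forall>W. openin T W \<longrightarrow> W \<in> sets PU) \<and>
          (\<forall>x\<in>space MX. bel_event_closed T PU \<Theta> a A PS x \<in> sets PS) \<longrightarrow>
            (\<exists>PS'. predictive_random_set PU PS' \<and> nested_prs PU PS' \<and> valid_prs PU PS' \<and>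
              (\<forall>x\<in>space MX. bel_event_closed T PU \<Theta> a A PS' x \<in> sets PS' \<and>
                 bel_closed T PU \<Theta> a A PS' x \<ge> bel_closed T PU \<Theta> a A PS x)))"
proof (intro conjI allI impI; elim conjE)
  have PU: "prob_space PU"
    using assms(1) by (simp add: association_def)
  assume disc: "discrete_space MX"
  \<comment> \<open>Countability of the sample space makes this a countable union of measurable
    sets.\<close>
  have "(\<Union>y\<in>J. space PU - U_set PU \<Theta> a A y) \<in> sets PU" if "J \<subseteq> space MX" for J
    using that assms(4) disc unfolding discrete_space_def
    by (intro sets.countable_UN'' sets.Diff sets.top) (auto intro: countable_subset)
  from nested_prs_dominating[OF PU assms(5,6) this, of "space MX"]
  obtain PS' where PS': "predictive_random_set PU PS'" "nested_prs PU PS'" "valid_prs PU PS'"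
    "\<forall>x\<in>space MX. {S \<in> space PS'. S \<subseteq> U_set PU \<Theta> a A x} \<in> sets PS' \<and>
       measure PS {S \<in> space PS. S \<subseteq> U_set PU \<Theta> a A x}
         \<le> measure PS' {S \<in> space PS'. S \<subseteq> U_set PU \<Theta> a A x}"
    by auto
  \<comment> \<open>These inclusions let \<open>bel_event_eq\<close> turn the subset events into
    belief events for both random sets.\<close>
  have "space PS \<subseteq> Pow (space PU)" "space PS' \<subseteq> Pow (space PU)"
    using assms(5) PS'(1) by (auto simp: predictive_random_set_def)
  then show "\<exists>PS'. predictive_random_set PU PS' \<and> nested_prs PU PS' \<and> valid_prs PU PS' \<and>
              (\<forall>x\<in>space MX. bel_event \<Theta> a A PS' x \<in> sets PS' \<and>
                 bel \<Theta> a A PS' x \<ge> bel \<Theta> a A PS x)"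
    using PS' by (intro exI[of _ PS']) (simp add: bel_def bel_event_eq)
next
  have PU: "prob_space PU"
    using assms(1) by (simp add: association_def)
  fix T
  assume T: "topspace T = space PU" "\<forall>W. openin T W \<longrightarrow> W \<in> sets PU"
  \<comment> \<open>Complements of closures are open, so any union of them is open and hence
    measurable, even for uncountable J.\<close>
  have "(\<Union>y\<in>J. space PU - T closure_of (U_set PU \<Theta> a A y)) \<in> sets PU" for J
    using T(2) openin_diff[OF openin_topspace closedin_closure_of, of T]
    unfolding T(1)[symmetric] by (intro T(2)[rule_format] openin_Union) auto
  from nested_prs_dominating[OF PU assms(5,6) this, of "space MX"]
  show "\<exists>PS'. predictive_random_set PU PS' \<and> nested_prs PU PS' \<and> valid_prs PU PS' \<and>
              (\<forall>x\<in>space MX. bel_event_closed T PU \<Theta> a A PS' x \<in> sets PS' \<and>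
                 bel_closed T PU \<Theta> a A PS' x \<ge> bel_closed T PU \<Theta> a A PS x)"
    unfolding bel_closed_def bel_event_closed_def .
qed

end
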